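(* Fix $\nu\in(0,1]$, $k\in\mathbb{N}$, $\lambda_1,\dots,\lambda_k>0$, $\Lambda=\lambda_1+\dots+\lambda_k$. Let $N^\nu_\Lambda(t)$ be a fractional Poisson process with intensity $\Lambda$, and $(X_i)_{i\ge1}$ i.i.d., independent of $N^\nu_\Lambda$, with $\mathbb{P}\{X_i=j\}=\lambda_j/\Lambda$, $j=1,\dots,k$. Let $M^\nu(t)=\sum_{i=1}^{N^\nu_\Lambda(t)}X_i$ and, for $j\in\{1,\dots,k\}$, $M^\nu_j(t)=\sum_{i=1}^{N^\nu_\Lambda(t)}\mathbf{1}_{\{X_i=j\}}$ (the number of jumps of amplitude $j$ in $(0,t]$) and $H_j=\inf\{s>0:M^\nu_j(s)=1\}$. Then \[ \mathbb{P}\{H_j\le t\}=\lambda_j t^\nu E_{\nu,\nu+1}(-\lambda_jt^\nu),\qquad t>0. \]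
   Context: The fractional Poisson process $N^\nu_\lambda(t)$ with intensity $\lambda>0$ is the renewal process (with $N^\nu_\lambda(0)=0$) whose i.i.d. interarrival times have density $\lambda t^{\nu-1}E_{\nu,\nu}(-\lambda t^\nu)$, $t>0$, where $E_{\alpha,\beta}(x)=\sum_{r\ge0}\frac{x^r}{\Gamma(\alpha r+\beta)}$ is the two-parameter Mittag-Leffler function. *)

theory Defs
  imports "HOL-Probability.Probability"
begin

definition mittag_leffler :: "real \<Rightarrow> real \<Rightarrow> real \<Rightarrow> real" where
  "mittag_leffler a b x = (\<Sum>r. x ^ r / Gamma (a * real r + b))"

text \<open>Interarrival density of the fractional Poisson process with intensity lam:
  lam t^(nu-1) E_{nu,nu}(-lam t^nu) for t > 0, and 0 otherwise.\<close>
definition fpp_density :: "real \<Rightarrow> real \<Rightarrow> real \<Rightarrow> real" where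
  "fpp_density nu lam t =
     (if 0 < t then lam * t powr (nu - 1) * mittag_leffler nu nu (- lam * t powr nu) else 0)"

definition renewal_count :: "(nat \<Rightarrow> 'a \<Rightarrow> real) \<Rightarrow> real \<Rightarrow> 'a \<Rightarrow> nat" where
  "renewal_count T t \<omega> = card {n. 1 \<le> n \<and> (\<Sum>i<n. T i \<omega>) \<le> t}"

definition mark_count ::
  "(nat \<Rightarrow> 'a \<Rightarrow> real) \<Rightarrow> (nat \<Rightarrow> 'a \<Rightarrow> nat) \<Rightarrow> nat \<Rightarrow> real \<Rightarrow> 'a \<Rightarrow> nat" where
  "mark_count T X j t \<omega> = card {i. i < renewal_count T t \<omega> \<and> X i \<omega> = j}"

text \<open>First hitting time H_j = inf {s > 0. M_j(s) = 1}, in the extended reals (inf {} = infinity).\<close>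
definition first_mark_time ::
  "(nat \<Rightarrow> 'a \<Rightarrow> real) \<Rightarrow> (nat \<Rightarrow> 'a \<Rightarrow> nat) \<Rightarrow> nat \<Rightarrow> 'a \<Rightarrow> ereal" where
  "first_mark_time T X j \<omega> = Inf {ereal s | s. 0 < s \<and> mark_count T X j s \<omega> = 1}"

end

theory Submission
  imports Defs
begin

text \<open>Almost surely \<open>H_j\<close> is the arrival time \<open>T_0 + ... + T_n\<close>, where \<open>n\<close> is the first index with \<open>X_n = j\<close>.
  With \<open>p = lam j / L\<close>, where \<open>L\<close> is the total intensity, the distribution function of \<open>H_j\<close> is
  therefore the geometric mixture of the distribution functions of the arrival times, the bounded
  solution \<open>G\<close> of \<open>G u = E (p 1_{T \<le> u} + (1 - p) G (u - T))\<close>.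
  All functions involved are series in the kernels \<open>t^(b - 1) / Gamma b\<close>; these convolve by adding the
  parameters \<open>b\<close>, so convolution of series is the Cauchy product of coefficients, and the equation for
  \<open>G = p L t^nu E_{nu,nu+1}(- p L t^nu)\<close> becomes a geometric sum.

  The hypotheses describe the law of \<open>T\<close> by the positive part of the density, so positivity of
  \<open>E_{nu,nu}\<close> on the negative axis is needed as well. It follows from the Volterra equation
  \<open>g = k - k * g\<close> for \<open>g t = t^(nu - 1) E_{nu,nu}(- t^nu)\<close> and the log-convexity of \<open>k t = t^(nu - 1) / Gamma nu\<close>.\<close>

section \<open>Growth of the Gamma function and convergence of Mittag-Leffler series\<close>

lemma Gamma_real_ge_powr:
  fixes y z :: real
  assumes "1 \<le> y" "0 < z"
  shows "z powr (y - 1) * exp (- (z + 1)) \<le> Gamma y"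
proof -
  let ?f = "\<lambda>t. t powr (y - 1) / exp t"
  have "?f integrable_on {z..z + 1}"
    using assms by (intro integrable_continuous_interval continuous_intros) auto
  then obtain I where I: "(?f has_integral I) {z..z + 1}"
    by (auto simp: integrable_on_def)
  \<comment> \<open>The integrand is nonnegative, so Euler's integral dominates its part over this
    window. As \<open>z\<close> is free, Gamma outgrows every geometric sequence.\<close>
  have "I \<le> Gamma y"
    using assms by (intro has_integral_subset_le[OF _ I Gamma_integral_real]) auto
  moreover have "z powr (y - 1) * exp (- (z + 1)) \<le> I"
  proof (rule has_integral_le[OF _ I])
    show "((\<lambda>t. z powr (y - 1) * exp (- (z + 1))) has_integral z powr (y - 1) * exp (- (z + 1))) {z..z + 1}"
      using has_integral_const_real[of "z powr (y - 1) * exp (- (z + 1))" z "z + 1"] by simp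
    fix t assume "t \<in> {z..z + 1}"
    then have "z powr (y - 1) \<le> t powr (y - 1)" "exp (- (z + 1)) \<le> exp (- t)"
      using assms by (auto intro!: powr_mono2)
    then have "z powr (y - 1) * exp (- (z + 1)) \<le> t powr (y - 1) * exp (- t)"
      by (intro mult_mono) auto
    then show "z powr (y - 1) * exp (- (z + 1)) \<le> t powr (y - 1) / exp t"
      by (simp add: exp_minus divide_simps)
  qed
  ultimately show ?thesis by simp
qed

text \<open>For a suitable fixed \<open>z\<close> the Gamma bound makes the denominators at least a
  constant times \<open>(2 * (|x| + 1)) ^ r\<close>, so the terms are eventually dominated by a
  multiple of \<open>(1 / 2) ^ r\<close>.\<close>

lemma summable_power_div_Gamma:
  fixes a b x :: real
  assumes "0 < a" "0 < b"
  shows "summable (\<lambda>r. \<bar>x ^ r / Gamma (a * real r + b)\<bar>)"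
proof -
  define z where "z = (2 * (\<bar>x\<bar> + 1)) powr (1 / a)"
  have z: "0 < z" "z powr a = 2 * (\<bar>x\<bar> + 1)"
    using assms by (auto simp: z_def powr_powr)
  define K where "K = inverse (exp (- (z + 1))) * z powr (1 - b)"
  \<comment> \<open>Beyond \<open>N\<close> the Gamma argument is at least 1, as the lower bound for
    Gamma requires.\<close>
  obtain N where N: "1 / a \<le> real N" using real_arch_simple by blast
  have "\<bar>x ^ r / Gamma (a * real r + b)\<bar> \<le> K * (1 / 2) ^ r" if "r \<ge> N" for r
  proof -
    have "1 \<le> a * real N" using N assms by (simp add: field_simps)
    also have "\<dots> \<le> a * real r" using that assms by simp
    finally have y: "1 \<le> a * real r + b" using assms by simp
    have "z powr (a * real r + b - 1) * exp (- (z + 1)) \<le> Gamma (a * real r + b)"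
      by (rule Gamma_real_ge_powr[OF y z(1)])
    then have "inverse (Gamma (a * real r + b)) \<le> inverse (z powr (a * real r + b - 1) * exp (- (z + 1)))"
      by (rule le_imp_inverse_le) (use z in simp)
    also have "\<dots> = K * inverse ((z powr a) ^ r)"
      using z(1) by (simp add: K_def powr_realpow[symmetric] powr_powr powr_diff powr_add field_simps)
    finally have "inverse (Gamma (a * real r + b)) \<le> K * inverse ((2 * (\<bar>x\<bar> + 1)) ^ r)" using z by simp
    moreover have "0 < Gamma (a * real r + b)" using y by (intro Gamma_real_pos) auto
    ultimately have "\<bar>x ^ r / Gamma (a * real r + b)\<bar> \<le> \<bar>x\<bar> ^ r * (K * inverse ((2 * (\<bar>x\<bar> + 1)) ^ r))"
      by (auto simp: abs_mult power_abs divide_inverse intro!: mult_left_mono)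
    also have "\<dots> = K * (\<bar>x\<bar> / (2 * (\<bar>x\<bar> + 1))) ^ r"
      by (simp only: power_divide divide_inverse power_mult_distrib power_inverse mult_ac)
    also have "\<dots> \<le> K * (1 / 2) ^ r"
      by (intro mult_left_mono power_mono) (auto simp: K_def field_simps)
    finally show ?thesis .
  qed
  then show ?thesis
    by (intro summable_comparison_test'[where N = N, OF summable_mult[OF summable_geometric]]) auto
qed

subsection \<open>Series of fractional kernels\<close>

text \<open>The kernel of the Riemann-Liouville fractional integral of order \<open>b\<close>. The
  cut-off at 0 turns convolution over the whole line into convolution over
  \<open>(0, t)\<close>.\<close>

definition frac_kernel :: "real \<Rightarrow> real \<Rightarrow> real" where
  "frac_kernel b t = (if 0 < t then t powr (b - 1) / Gamma b else 0)"

text \<open>Geometric coefficients give Mittag-Leffler functions; general ones are allowed because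
  convolution leads out of the geometric case.\<close>

definition frac_series :: "real \<Rightarrow> real \<Rightarrow> (nat \<Rightarrow> real) \<Rightarrow> real \<Rightarrow> real" where
  "frac_series a b d t = (\<Sum>r. d r * frac_kernel (a * real r + b) t)"

lemma frac_kernel_measurable [measurable]: "frac_kernel b \<in> borel_measurable borel"
  unfolding frac_kernel_def by measurable

lemma frac_series_measurable [measurable]: "frac_series a b d \<in> borel_measurable borel"
  unfolding frac_series_def by measurable

lemma frac_kernel_nonneg: "0 < b \<Longrightarrow> 0 \<le> frac_kernel b t"
  by (auto simp: frac_kernel_def intro!: divide_nonneg_nonneg less_imp_le[OF Gamma_real_pos])

lemma frac_series_eq_0: "t \<le> 0 \<Longrightarrow> frac_series a b d t = 0"
  by (simp add: frac_series_def frac_kernel_def)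

lemma frac_kernel_eq_power:
  "0 < t \<Longrightarrow> frac_kernel (a * real r + b) t = t powr (b - 1) * ((t powr a) ^ r / Gamma (a * real r + b))"
  by (simp add: frac_kernel_def powr_realpow[symmetric] powr_powr powr_add[symmetric] powr_diff algebra_simps)

text \<open>Geometrically bounded coefficients are dominated by the Mittag-Leffler series at
  \<open>B * t powr a\<close>.\<close>

lemma frac_series_summable:
  assumes "0 < a" "0 < b" and d: "\<And>r. \<bar>d r\<bar> \<le> D * B ^ r"
  shows "summable (\<lambda>r. \<bar>d r * frac_kernel (a * real r + b) t\<bar>)"
proof (cases "0 < t")
  case True
  show ?thesis
  proof (rule summable_comparison_test')
    show "summable (\<lambda>r. D * t powr (b - 1) * \<bar>(B * t powr a) ^ r / Gamma (a * real r + b)\<bar>)"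
      by (intro summable_mult summable_power_div_Gamma assms)
    fix r :: nat
    have "\<bar>d r\<bar> * frac_kernel (a * real r + b) t \<le> \<bar>D * B ^ r\<bar> * frac_kernel (a * real r + b) t"
      using assms(1,2) by (intro mult_right_mono frac_kernel_nonneg add_nonneg_pos order.trans[OF d abs_ge_self]) auto
    also have "\<dots> = D * t powr (b - 1) * \<bar>(B * t powr a) ^ r / Gamma (a * real r + b)\<bar>"
    proof -
      have "0 \<le> D" using d[of 0] by simp
      moreover have "0 < Gamma (a * real r + b)"
        using assms by (intro Gamma_real_pos add_nonneg_pos) auto
      ultimately show ?thesis
        using True by (simp add: frac_kernel_eq_power abs_mult power_mult_distrib)
    qed
    finally show "norm \<bar>d r * frac_kernel (a * real r + b) t\<bar>
        \<le> D * t powr (b - 1) * \<bar>(B * t powr a) ^ r / Gamma (a * real r + b)\<bar>"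
      using frac_kernel_nonneg[of "a * real r + b" t] assms by (simp add: abs_mult add_nonneg_pos)
  qed
qed (simp add: frac_kernel_def)

text \<open>The substitution \<open>s = t * x\<close> yields Euler's Beta integral. Working with the
  nonnegative integral first gives integrability despite the endpoint singularities.\<close>

lemma frac_kernel_convolution:
  assumes "0 < b" "0 < c"
  shows "has_bochner_integral lborel (\<lambda>s. frac_kernel b s * frac_kernel c (t - s)) (frac_kernel (b + c) t)"
proof (cases "0 < t")
  case False
  then have eq: "(\<lambda>s. frac_kernel b s * frac_kernel c (t - s)) = (\<lambda>_. 0)"
    by (auto simp: frac_kernel_def)
  have "frac_kernel (b + c) t = 0" using False by (simp add: frac_kernel_def)
  then show ?thesis unfolding eq by (simp add: has_bochner_integral_zero)
next
  case t: True
  define A where "A = t powr (b + c - 2) / (Gamma b * Gamma c)"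
  have G: "0 < Gamma b" "0 < Gamma c" "0 < Gamma (b + c)" using assms by (auto intro!: Gamma_real_pos)
  have A: "0 \<le> A" using G by (simp add: A_def)
  have eq: "frac_kernel b (0 + t * x) * frac_kernel c (t - (0 + t * x))
      = A * (x powr (b - 1) * (1 - x) powr (c - 1) * indicator {0..1} x)" for x
  proof (cases "0 < x \<and> x < 1")
    case True
    then have "t - t * x = t * (1 - x)" "0 < t * (1 - x)" using t by (auto simp: algebra_simps)
    moreover have "t powr (b + c - 2) = t powr (b - 1) * t powr (c - 1)"
      using t by (simp add: powr_add[symmetric])
    ultimately show ?thesis using True t
      by (simp add: frac_kernel_def A_def powr_mult indicator_def)
  next
    case False
    \<comment> \<open>At \<open>x = 0\<close> and \<open>x = 1\<close> the right-hand side vanishes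
      too, because \<open>0 powr y = 0\<close>.\<close>
    have "\<not> (0 < t * x \<and> 0 < t - t * x)"
      using False t by (auto simp: zero_less_mult_iff)
    with False show ?thesis by (auto simp: frac_kernel_def indicator_def)
  qed
  have "(\<integral>\<^sup>+s. ennreal (frac_kernel b s * frac_kernel c (t - s)) \<partial>lborel)
    = ennreal t * (\<integral>\<^sup>+x. ennreal (frac_kernel b (0 + t * x) * frac_kernel c (t - (0 + t * x))) \<partial>lborel)"
    using t nn_integral_real_affine[of "\<lambda>s. ennreal (frac_kernel b s * frac_kernel c (t - s))" t 0] by simp
  also have "\<dots> = ennreal t * (\<integral>\<^sup>+x. ennreal A * (ennreal (x powr (b - 1) * (1 - x) powr (c - 1)) * indicator {0..1} x) \<partial>lborel)"
  proof (intro arg_cong2[where f = "(*)"] refl nn_integral_cong)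
    fix x :: real
    show "ennreal (frac_kernel b (0 + t * x) * frac_kernel c (t - (0 + t * x)))
        = ennreal A * (ennreal (x powr (b - 1) * (1 - x) powr (c - 1)) * indicator {0..1} x)"
      unfolding eq using A by (cases "x \<in> {0..1}") (simp_all add: ennreal_mult)
  qed
  also have "\<dots> = ennreal t * (ennreal A * ennreal (Beta b c))"
    by (subst nn_integral_cmult, simp)
      (subst nn_integral_has_integral_lebesgue'[OF _ has_integral_Beta_real[OF assms]], auto)
  also have "\<dots> = ennreal (frac_kernel (b + c) t)"
  proof -
    have "t * (A * Beta b c) = frac_kernel (b + c) t"
      using G t by (simp add: A_def Beta_def frac_kernel_def powr_diff powr_add power2_eq_square)
    moreover have "0 \<le> Beta b c" using G by (simp add: Beta_def)
    ultimately show ?thesis using t A by (simp add: ennreal_mult[symmetric])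
  qed
  finally show ?thesis
    using assms by (intro has_bochner_integral_nn_integral)
      (auto intro!: mult_nonneg_nonneg frac_kernel_nonneg)
qed

text \<open>The product of the series is expanded as a Cauchy product. All terms of index
  \<open>m\<close> integrate to multiples of the same kernel, and sum and integral commute by
  absolute convergence.\<close>

lemma frac_series_convolution:
  assumes "0 < a" "0 < b" "0 < b'"
    and d: "\<And>r. \<bar>d r\<bar> \<le> D * B ^ r" and c: "\<And>r. \<bar>c r\<bar> \<le> C * B ^ r"
  shows "has_bochner_integral lborel (\<lambda>s. frac_series a b d s * frac_series a b' c (t - s))
    (frac_series a (b + b') (\<lambda>m. \<Sum>i\<le>m. d i * c (m - i)) t)"
proof -
  define k where "k m i s = d i * frac_kernel (a * real i + b) s *
     (c (m - i) * frac_kernel (a * real (m - i) + b') (t - s))" for m i s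
  define h where "h m s = (\<Sum>i\<le>m. k m i s)" for m s
  have nn: "0 \<le> a * real i" for i using assms by simp
  have DC: "0 \<le> D" "0 \<le> C" using d[of 0] c[of 0] by auto
  have k: "has_bochner_integral lborel (k m i) (d i * c (m - i) * frac_kernel (a * real m + (b + b')) t)" 
    if "i \<le> m" for m i
  proof -
    have "has_bochner_integral lborel (\<lambda>s. d i * c (m - i) * (frac_kernel (a * real i + b) s * frac_kernel (a * real (m - i) + b') (t - s)))
        (d i * c (m - i) * frac_kernel ((a * real i + b) + (a * real (m - i) + b')) t)"
      using assms nn by (intro has_bochner_integral_mult_right frac_kernel_convolution add_nonneg_pos) auto
    moreover have "(a * real i + b) + (a * real (m - i) + b') = a * real m + (b + b')"
      using that by (simp add: of_nat_diff algebra_simps)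
    ultimately show ?thesis unfolding k_def by (simp add: mult_ac)
  qed
  have kn: "norm (k m i s) = \<bar>d i * c (m - i)\<bar> * (frac_kernel (a * real i + b) s * frac_kernel (a * real (m - i) + b') (t - s))"
    for m i s
    using assms nn frac_kernel_nonneg[of "a * real i + b" s] frac_kernel_nonneg[of "a * real (m - i) + b'" "t - s"]
    by (simp add: k_def abs_mult add_nonneg_pos mult_ac)
  have kni: "(\<integral>s. norm (k m i s) \<partial>lborel) = \<bar>d i * c (m - i)\<bar> * frac_kernel (a * real m + (b + b')) t"
    if "i \<le> m" for m i
  proof -
    have "has_bochner_integral lborel (\<lambda>s. \<bar>d i * c (m - i)\<bar> * (frac_kernel (a * real i + b) s * frac_kernel (a * real (m - i) + b') (t - s)))
        (\<bar>d i * c (m - i)\<bar> * frac_kernel ((a * real i + b) + (a * real (m - i) + b')) t)"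
      using assms nn by (intro has_bochner_integral_mult_right frac_kernel_convolution add_nonneg_pos) auto
    moreover have "(a * real i + b) + (a * real (m - i) + b') = a * real m + (b + b')"
      using that by (simp add: of_nat_diff algebra_simps)
    ultimately show ?thesis unfolding kn by (simp only: has_bochner_integral_integral_eq)
  qed
  have hI: "has_bochner_integral lborel (h m) ((\<Sum>i\<le>m. d i * c (m - i)) * frac_kernel (a * real m + (b + b')) t)" for m
    unfolding h_def sum_distrib_right by (intro has_bochner_integral_sum k) auto
  have hi: "integrable lborel (h m)" for m by (rule integrable.intros[OF hI])
  have kn_int: "integrable lborel (\<lambda>s. norm (k m i s))" if "i \<le> m" for m i
    by (rule Bochner_Integration.integrable_norm[OF integrable.intros[OF k[OF that]]])
  \<comment> \<open>The number \<open>m + 1\<close> of summands is absorbed into the base as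
    \<open>2 ^ m\<close>, so the product coefficients again have a geometric bound.\<close>
  have cauchy: "(\<Sum>i\<le>m. \<bar>d i * c (m - i)\<bar>) \<le> D * C * (2 * B) ^ m" for m
  proof -
    \<comment> \<open>The bound on \<open>d 1\<close> forces \<open>0 <= B\<close> unless
      \<open>D = 0\<close>, in which case the product below vanishes.\<close>
    have "0 \<le> D * B" using d[of 1] by (simp add: order_trans[OF abs_ge_zero])
    then have B: "0 \<le> D * C * B ^ m" using DC by (cases "D = 0") (auto simp: zero_le_mult_iff)
    have "\<bar>d i * c (m - i)\<bar> \<le> D * C * B ^ m" if "i \<le> m" for i
    proof -
      have "\<bar>d i * c (m - i)\<bar> \<le> (D * B ^ i) * (C * B ^ (m - i))"
        unfolding abs_mult using d[of i] c[of "m - i"] by (intro mult_mono) auto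
      also have "\<dots> = D * C * B ^ m" using that by (simp add: power_add[symmetric])
      finally show ?thesis .
    qed
    then have "(\<Sum>i\<le>m. \<bar>d i * c (m - i)\<bar>) \<le> real (m + 1) * (D * C * B ^ m)"
      using sum_bounded_above[of "{..m}" "\<lambda>i. \<bar>d i * c (m - i)\<bar>" "D * C * B ^ m"] by simp
    also have "\<dots> \<le> 2 ^ m * (D * C * B ^ m)"
    proof (rule mult_right_mono[OF _ B])
      have "m + 1 \<le> 2 ^ m" by (induction m) auto
      then show "real (m + 1) \<le> 2 ^ m" using of_nat_mono by fastforce
    qed
    finally show ?thesis by (simp add: power_mult_distrib mult_ac)
  qed
  have hsums: "(\<lambda>m. h m s) sums (frac_series a b d s * frac_series a b' c (t - s))" for s
    unfolding h_def k_def frac_series_def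
    using assms by (intro Cauchy_product_sums) (auto intro: frac_series_summable)
  have habs: "summable (\<lambda>m. norm (h m s))" for s
  proof (rule summable_comparison_test')
    have "(\<lambda>m. \<Sum>i\<le>m. norm (d i * frac_kernel (a * real i + b) s) * 
        norm (c (m - i) * frac_kernel (a * real (m - i) + b') (t - s))) sums 
       ((\<Sum>i. norm (d i * frac_kernel (a * real i + b) s)) * (\<Sum>i. norm (c i * frac_kernel (a * real i + b') (t - s))))"
      using assms by (intro Cauchy_product_sums) (auto intro: frac_series_summable)
    from sums_summable[OF this] show "summable (\<lambda>m. \<Sum>i\<le>m. norm (k m i s))"
      by (simp only: k_def norm_mult)
    show "norm (norm (h m s)) \<le> (\<Sum>i\<le>m. norm (k m i s))" for m
      unfolding h_def by (simp add: sum_abs)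
  qed
  \<comment> \<open>Summability of the L1 norms is what permits integrating the series term by
    term.\<close>
  have hint: "summable (\<lambda>m. \<integral>s. norm (h m s) \<partial>lborel)"
  proof (rule summable_comparison_test')
    show "summable (\<lambda>m. \<bar>D * C * (2 * B) ^ m * frac_kernel (a * real m + (b + b')) t\<bar>)"
      using assms by (intro frac_series_summable[where D = "D * C" and B = "\<bar>2 * B\<bar>"]) (auto simp: abs_mult power_abs DC)
    fix m
    have "(\<integral>s. norm (h m s) \<partial>lborel) \<le> (\<integral>s. (\<Sum>i\<le>m. norm (k m i s)) \<partial>lborel)"
    proof (rule integral_mono)
      show "integrable lborel (\<lambda>s. norm (h m s))" by (intro Bochner_Integration.integrable_norm hi)
      show "integrable lborel (\<lambda>s. \<Sum>i\<le>m. norm (k m i s))"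
        by (intro Bochner_Integration.integrable_sum kn_int) simp
      show "norm (h m s) \<le> (\<Sum>i\<le>m. norm (k m i s))" for s
        unfolding h_def by (rule norm_sum)
    qed
    also have "\<dots> = (\<Sum>i\<le>m. \<integral>s. norm (k m i s) \<partial>lborel)"
      by (intro Bochner_Integration.integral_sum kn_int) simp
    also have "\<dots> = (\<Sum>i\<le>m. \<bar>d i * c (m - i)\<bar>) * frac_kernel (a * real m + (b + b')) t"
      unfolding sum_distrib_right by (intro sum.cong refl kni) simp
    also have "\<dots> \<le> D * C * (2 * B) ^ m * frac_kernel (a * real m + (b + b')) t"
      using assms nn by (intro mult_right_mono cauchy frac_kernel_nonneg add_nonneg_pos) auto
    finally show "norm (\<integral>s. norm (h m s) \<partial>lborel) \<le> \<bar>D * C * (2 * B) ^ m * frac_kernel (a * real m + (b + b')) t\<bar>"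
      by simp
  qed
  have eq: "(\<lambda>s. \<Sum>m. h m s) = (\<lambda>s. frac_series a b d s * frac_series a b' c (t - s))"
    using hsums by (auto simp: sums_iff)
  have "integrable lborel (\<lambda>s. \<Sum>m. h m s)"
    by (intro integrable_suminf hi hint AE_I2 habs)
  moreover have "(\<integral>s. (\<Sum>m. h m s) \<partial>lborel) = (\<Sum>m. \<integral>s. h m s \<partial>lborel)"
    by (intro integral_suminf hi hint AE_I2 habs)
  ultimately show ?thesis
    using hI unfolding eq by (simp add: has_bochner_integral_iff frac_series_def)
qed

subsection \<open>Positivity of the interarrival density\<close>

lemma isCont_mittag_leffler:
  assumes "0 < a" "0 < b"
  shows "isCont (mittag_leffler a b) x"
proof -
  have "isCont (\<lambda>x. \<Sum>r. (1 / Gamma (a * real r + b)) * x ^ r) x"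
    using summable_rabs_cancel[OF summable_power_div_Gamma[OF assms]]
    by (intro isCont_powser_converges_everywhere) simp
  then show ?thesis by (simp add: mittag_leffler_def[abs_def])
qed

lemma mittag_leffler_0: "mittag_leffler a b 0 = 1 / Gamma b"
  using powser_zero[of "\<lambda>r. 1 / Gamma (a * real r + b)"] by (simp add: mittag_leffler_def)

text \<open>The dictionary between series and Mittag-Leffler functions, used for the density, for
  the claimed distribution function and for the Volterra solution.\<close>

lemma frac_series_geometric:
  assumes "0 < a" "0 < b" "0 < t"
  shows "frac_series a b (\<lambda>r. c * q ^ r) t = c * t powr (b - 1) * mittag_leffler a b (q * t powr a)"
proof -
  have "frac_series a b (\<lambda>r. c * q ^ r) t
      = (\<Sum>r. c * t powr (b - 1) * ((q * t powr a) ^ r / Gamma (a * real r + b)))"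
    using assms by (simp add: frac_series_def frac_kernel_eq_power power_mult_distrib mult_ac)
  also have "\<dots> = c * t powr (b - 1) * mittag_leffler a b (q * t powr a)"
    unfolding mittag_leffler_def
    by (intro suminf_mult summable_rabs_cancel[OF summable_power_div_Gamma] assms)
  finally show ?thesis .
qed

lemma frac_series_split_head:
  assumes "0 < a" "0 < b" and d: "\<And>r. \<bar>d r\<bar> \<le> D * B ^ r"
  shows "frac_series a b d t = d 0 * frac_kernel b t + frac_series a (a + b) (\<lambda>r. d (Suc r)) t"
  using suminf_split_head[OF summable_rabs_cancel[OF frac_series_summable[OF assms, of t]]]
  by (simp add: frac_series_def algebra_simps)

text \<open>The kernel is itself a series, so convolving with it keeps the coefficients
  \<open>(- 1) ^ r\<close> and raises the parameter by \<open>a\<close>. Up to sign, the result is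
  the series without its head.\<close>

lemma volterra_equation:
  assumes "0 < a"
  shows "has_bochner_integral lborel (\<lambda>s. frac_series a a (\<lambda>r. (- 1) ^ r) s * frac_kernel a (t - s))
    (frac_kernel a t - frac_series a a (\<lambda>r. (- 1) ^ r) t)"
proof -
  \<comment> \<open>The unit sequence for the Cauchy product; it represents
    \<open>frac_kernel a\<close> as a series.\<close>
  define c :: "nat \<Rightarrow> real" where "c r = of_bool (r = 0)" for r
  have c: "frac_series a a c = frac_kernel a"
  proof
    fix u
    have "frac_series a a c u = (\<Sum>r\<in>{0}. c r * frac_kernel (a * real r + a) u)"
      unfolding frac_series_def by (intro suminf_finite) (auto simp: c_def)
    then show "frac_series a a c u = frac_kernel a u" by (simp add: c_def)
  qed
  have m: "(\<Sum>i\<le>m. (- 1) ^ i * c (m - i)) = (- 1) ^ m" for m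
  proof -
    have "(\<Sum>i\<le>m. (- 1) ^ i * c (m - i)) = (\<Sum>i\<le>m. if i = m then (- 1) ^ i else 0)"
      by (intro sum.cong) (auto simp: c_def)
    then show ?thesis by simp
  qed
  have "has_bochner_integral lborel (\<lambda>s. frac_series a a (\<lambda>r. (- 1) ^ r) s * frac_series a a c (t - s))
    (frac_series a (a + a) (\<lambda>m. \<Sum>i\<le>m. (- 1) ^ i * c (m - i)) t)"
    using assms by (intro frac_series_convolution[where D = 1 and C = 1 and B = 1])
      (auto simp: c_def power_abs)
  moreover have "frac_series a (a + a) (\<lambda>m. (- 1) ^ m) t = frac_kernel a t - frac_series a a (\<lambda>r. (- 1) ^ r) t"
  proof -
    have "summable (\<lambda>r. (- 1) ^ r * frac_kernel (a * real r + (a + a)) t)"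
      using assms by (intro summable_rabs_cancel[OF frac_series_summable[where D = 1 and B = 1]]) (auto simp: power_abs)
    then have "frac_series a (a + a) (\<lambda>r. (- 1) ^ Suc r) t = - frac_series a (a + a) (\<lambda>r. (- 1) ^ r) t"
      unfolding frac_series_def by (subst suminf_minus[symmetric]) auto
    then show ?thesis
      using frac_series_split_head[OF assms assms, of "\<lambda>r. (- 1) ^ r" 1 1 t] by (simp add: power_abs)
  qed
  ultimately show ?thesis by (simp add: m c)
qed

text \<open>Since \<open>a - 1 <= 0\<close>, the power reverses
  \<open>v * (u - s) <= u * (v - s)\<close>. In other words, the ratio of \<open>k (y - s)\<close>
  to \<open>k y\<close> does not increase with \<open>y\<close>.\<close>

lemma frac_kernel_log_convex:
  assumes "0 < a" "a \<le> 1" "0 < s" "s < u" "u \<le> v"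
  shows "frac_kernel a u * frac_kernel a (v - s) \<le> frac_kernel a v * frac_kernel a (u - s)"
proof -
  have "v * (u - s) \<le> u * (v - s)" using assms by (simp add: algebra_simps)
  then have "(u * (v - s)) powr (a - 1) \<le> (v * (u - s)) powr (a - 1)"
    using assms by (intro powr_mono2') auto
  then have "(u * (v - s)) powr (a - 1) / (Gamma a * Gamma a) \<le> (v * (u - s)) powr (a - 1) / (Gamma a * Gamma a)"
    by (intro divide_right_mono) auto
  then show ?thesis using assms by (simp add: frac_kernel_def powr_mult)
qed

text \<open>At the first point \<open>u\<close> with \<open>g u \<le> 0\<close>, comparing the Volterra equations at \<open>u\<close> and at \<open>t < u\<close>
  bounds \<open>k u * g t\<close> by \<open>k t\<close> times the integral of \<open>k (u - s) * g s\<close> over \<open>t < s < u\<close>. If \<open>t\<close> maximises \<open>g\<close> on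
  a short interval ending at \<open>u\<close>, this is less than \<open>k u * g t\<close>.\<close>
lemma mittag_leffler_pos:
  assumes a: "0 < a" "a \<le> 1" and "0 \<le> x"
  shows "0 < mittag_leffler a a (- x)"
proof (rule ccontr)
  assume neg: "\<not> 0 < mittag_leffler a a (- x)"
  define e where "e y = mittag_leffler a a (- y)" for y
  define g where "g = frac_series a a (\<lambda>r. (- 1) ^ r)"
  define k where "k = frac_kernel a"
  have cont: "continuous_on A e" for A
    unfolding e_def by (intro continuous_at_imp_continuous_on ballI isCont_o2[OF _ isCont_mittag_leffler]) (use a in auto)
  have geq: "g t = t powr (a - 1) * e (t powr a)" if "0 < t" for t
    using frac_series_geometric[of a a t 1 "-1"] that a by (simp add: g_def e_def)
  have cont_g: "continuous_on A g" if "A \<subseteq> {0<..}" for A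
  proof -
    have "continuous_on A (\<lambda>t. t powr (a - 1) * e (t powr a))"
      using that by (intro continuous_intros continuous_on_compose2[OF cont]) auto
    then show ?thesis using geq that by (subst continuous_on_cong[OF refl]) auto
  qed
  \<comment> \<open>The first nonpositive point is sought for the continuous factor
    \<open>e\<close>, because \<open>g\<close> may blow up at 0. The map \<open>t powr a\<close>
    carries it over to \<open>g\<close>.\<close>
  define S where "S = {0..x} \<inter> e -` {..0}"
  have "compact S"
    unfolding S_def compact_eq_bounded_closed
    by (intro conjI continuous_closed_preimage cont bounded_subset[OF bounded_closed_interval]) auto
  moreover have "x \<in> S" using neg assms by (auto simp: S_def e_def)
  ultimately obtain x0 where "x0 \<in> S" "\<And>y. y \<in> S \<Longrightarrow> x0 \<le> y"
    using compact_attains_inf[of S] by blast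
  then have x0: "0 \<le> x0" "x0 \<le> x" "e x0 \<le> 0"
    and min: "\<And>y. 0 \<le> y \<Longrightarrow> y \<le> x \<Longrightarrow> e y \<le> 0 \<Longrightarrow> x0 \<le> y"
    by (auto simp: S_def)
  have "0 < e 0" using a by (simp add: e_def mittag_leffler_0 Gamma_real_pos)
  then have "0 < x0" using x0 by (cases "x0 = 0") auto
  define u where "u = x0 powr (1 / a)"
  have u: "0 < u" "u powr a = x0" using \<open>0 < x0\<close> a by (auto simp: u_def powr_powr)
  have gu: "g u \<le> 0" using geq[OF u(1)] u x0 by (simp add: mult_nonneg_nonpos)
  have gpos: "0 < g t" if "0 < t" "t < u" for t
  proof -
    have "t powr a < x0" using powr_less_mono2[of a t u] that a u by simp
    then have "0 < e (t powr a)" using min[of "t powr a"] x0 by force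
    then show ?thesis using geq that by simp
  qed
  \<comment> \<open>The second factor is the integral of \<open>k (u - s)\<close> over
    \<open>t < s < u\<close>. The product tends to 0 as \<open>t\<close> increases to
    \<open>u\<close>, hence falls below \<open>k u > 0\<close>.\<close>
  have "((\<lambda>t. t powr (a - 1) / Gamma a * ((u - t) powr a / Gamma (1 + a))) \<longlongrightarrow>
      u powr (a - 1) / Gamma a * ((u - u) powr a / Gamma (1 + a))) (at_left u)"
    using a u by (intro tendsto_intros tendsto_powr' ) (auto simp: eventually_at_left_field intro!: exI[of _ 0] Gamma_real_pos less_imp_neq[THEN not_sym])
  then have "\<forall>\<^sub>F t in at_left u. t powr (a - 1) / Gamma a * ((u - t) powr a / Gamma (1 + a)) < k u"
    using a u by (intro order_tendstoD(2)) (auto simp: k_def frac_kernel_def Gamma_real_pos)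
  then obtain w where w: "w < u" "\<And>t. w < t \<Longrightarrow> t < u \<Longrightarrow>
      t powr (a - 1) / Gamma a * ((u - t) powr a / Gamma (1 + a)) < k u"
    by (auto simp: eventually_at_left_field)
  \<comment> \<open>The midpoint lies beyond \<open>w\<close> and is positive, so \<open>g\<close>
    is continuous on the closed interval from \<open>w'\<close> to \<open>u\<close>.\<close>
  define w' where "w' = (max w 0 + u) / 2"
  have w': "w < w'" "0 < w'" "w' < u" using w u by (auto simp: w'_def max_def field_simps)
  have "\<exists>t\<in>{w'..u}. \<forall>y\<in>{w'..u}. g y \<le> g t"
    using w' by (intro continuous_attains_sup cont_g) auto
  then obtain t where t: "w' \<le> t" "t \<le> u" and max: "\<And>y. w' \<le> y \<Longrightarrow> y \<le> u \<Longrightarrow> g y \<le> g t" by auto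
  have "0 < g t" using gpos[of w'] max[of w'] w' by linarith
  then have "t \<noteq> u" using gu by auto
  then have tu: "0 < t" "t < u" using t w' by auto
  have k0: "0 \<le> k y" for y unfolding k_def using a by (intro frac_kernel_nonneg)
  have V: "has_bochner_integral lborel (\<lambda>s. g s * k (y - s)) (k y - g y)" for y
    unfolding g_def k_def by (rule volterra_equation[OF a(1)])
  \<comment> \<open>In this combination of the Volterra equations at \<open>u\<close> and
    \<open>t\<close> the terms \<open>k t * k u\<close> cancel.\<close>
  have I1: "has_bochner_integral lborel (\<lambda>s. k t * (g s * k (u - s)) - k u * (g s * k (t - s)))
      (k t * (k u - g u) - k u * (k t - g t))"
    by (intro has_bochner_integral_diff has_bochner_integral_mult_right V)
  \<comment> \<open>\<open>frac_kernel 1 (s - t)\<close> is the indicator of \<open>t < s\<close>;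
    the argument is written \<open>- t + 1 * s\<close> to match the affine substitution
    rule.\<close>
  have I2: "has_bochner_integral lborel (\<lambda>s. k t * g t * (frac_kernel 1 (- t + 1 * s) * frac_kernel a ((u - t) - (- t + 1 * s))))
      (k t * g t * frac_kernel (1 + a) (u - t))"
  proof (rule has_bochner_integral_mult_right)
    show "has_bochner_integral lborel (\<lambda>s. frac_kernel 1 (- t + 1 * s) * frac_kernel a ((u - t) - (- t + 1 * s))) (frac_kernel (1 + a) (u - t))"
      using lborel_has_bochner_integral_real_affine_iff[of 1 "\<lambda>s. frac_kernel 1 s * frac_kernel a (u - t - s)" "frac_kernel (1 + a) (u - t)" "- t"]
        frac_kernel_convolution[of 1 a "u - t"] a by simp
  qed
  \<comment> \<open>Below \<open>t\<close> log-convexity makes the left side nonpositive. Between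
    \<open>t\<close> and \<open>u\<close> the term with \<open>k (t - s)\<close> vanishes and
    \<open>g s <= g t\<close>. Elsewhere both sides are 0, except at \<open>s = t\<close>, a null
    set.\<close>
  have le: "AE s in lborel. k t * (g s * k (u - s)) - k u * (g s * k (t - s))
     \<le> k t * g t * (frac_kernel 1 (- t + 1 * s) * frac_kernel a ((u - t) - (- t + 1 * s)))"
    using AE_lborel_singleton[of t]
  proof eventually_elim
    case (elim s)
    consider "s \<le> 0" | "0 < s" "s < t" | "t < s" "s < u" | "u \<le> s" using elim by linarith
    then show ?case
    proof cases
      case 1
      then show ?thesis using tu by (simp add: g_def frac_series_eq_0 frac_kernel_def)
    next
      case 2
      have "g s * (k t * k (u - s)) \<le> g s * (k u * k (t - s))"
        unfolding k_def using 2 tu a gpos[of s] by (intro mult_left_mono frac_kernel_log_convex) auto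
      then show ?thesis using 2 tu by (simp add: frac_kernel_def mult_ac)
    next
      case 3
      have "k t * (g s * k (u - s)) \<le> k t * (g t * k (u - s))"
        using 3 t k0 by (intro mult_left_mono mult_right_mono max) auto
      then show ?thesis using 3 by (simp add: frac_kernel_def k_def mult_ac)
    next
      case 4
      then show ?thesis using tu by (simp add: frac_kernel_def k_def)
    qed
  qed
  have "k t * (k u - g u) - k u * (k t - g t) \<le> k t * g t * frac_kernel (1 + a) (u - t)"
  proof -
    have "k t * (k u - g u) - k u * (k t - g t) = (\<integral>s. k t * (g s * k (u - s)) - k u * (g s * k (t - s)) \<partial>lborel)"
      by (rule has_bochner_integral_integral_eq[OF I1, symmetric])
    also have "\<dots> \<le> (\<integral>s. k t * g t * (frac_kernel 1 (- t + 1 * s) * frac_kernel a ((u - t) - (- t + 1 * s))) \<partial>lborel)"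
      by (rule integral_mono_AE[OF integrable.intros[OF I1] integrable.intros[OF I2] le])
    also have "\<dots> = k t * g t * frac_kernel (1 + a) (u - t)"
      by (rule has_bochner_integral_integral_eq[OF I2])
    finally show ?thesis .
  qed
  moreover have "k t * g u \<le> 0" using gu k0 by (simp add: mult_nonneg_nonpos)
  ultimately have "k u * g t \<le> (k t * frac_kernel (1 + a) (u - t)) * g t" by (simp add: algebra_simps)
  then have "k u \<le> k t * frac_kernel (1 + a) (u - t)" using \<open>0 < g t\<close> by simp
  moreover have "k t * frac_kernel (1 + a) (u - t) < k u"
    using w(2)[of t] w' t tu by (simp add: k_def frac_kernel_def)
  ultimately show False by simp
qed

lemma fpp_density_eq_frac_series:
  assumes "0 < nu"
  shows "fpp_density nu c t = frac_series nu nu (\<lambda>r. c * (- c) ^ r) t"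
  using frac_series_geometric[OF assms assms, of t c "- c"]
  by (auto simp: fpp_density_def frac_series_eq_0)

lemma fpp_density_nonneg:
  assumes "0 < nu" "nu \<le> 1" "0 < c"
  shows "0 \<le> fpp_density nu c t"
  using mittag_leffler_pos[of nu "c * t powr nu"] assms by (auto simp: fpp_density_def less_imp_le)

subsection \<open>The renewal equation\<close>

text \<open>The remainder after each further term is \<open>1 - p\<close> times the previous
  remainder convolved with the probability density \<open>f\<close>, so it decays geometrically. A
  bound up to \<open>t\<close> suffices, since \<open>f\<close> lives on positive \<open>s\<close>
  and only values at \<open>u - s <= t\<close> enter.\<close>

lemma geometric_renewal_sums:
  fixes f G :: "real \<Rightarrow> real" and F :: "nat \<Rightarrow> real \<Rightarrow> real"
  assumes p: "0 < p" "p \<le> 1"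
    and f: "\<And>s. 0 \<le> f s" "\<And>s. s \<le> 0 \<Longrightarrow> f s = 0" "has_bochner_integral lborel f 1"
    and F: "\<And>n u. has_bochner_integral lborel (\<lambda>s. f s * F n (u - s)) (F (Suc n) u)"
    and G: "\<And>u. has_bochner_integral lborel (\<lambda>s. f s * (p * F 0 (u - s) + (1 - p) * G (u - s))) (G u)"
    and bound: "\<And>u. u \<le> t \<Longrightarrow> \<bar>G u\<bar> \<le> C"
  shows "(\<lambda>n. p * (1 - p) ^ n * F (Suc n) t) sums G t"
proof -
  define R where "R N u = G u - (\<Sum>n<N. p * (1 - p) ^ n * F (Suc n) u)" for N u
  have R: "has_bochner_integral lborel (\<lambda>s. (1 - p) * (f s * R N (u - s))) (R (Suc N) u)" for N u
  proof -
    \<comment> \<open>The equation for \<open>G\<close> minus the recursions for \<open>F\<close>;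
      the term with \<open>F 0\<close> cancels and the others shift by one index.\<close>
    have "has_bochner_integral lborel
        (\<lambda>s. f s * (p * F 0 (u - s) + (1 - p) * G (u - s)) - p * (f s * F 0 (u - s))
           - (\<Sum>n<N. p * (1 - p) ^ Suc n * (f s * F (Suc n) (u - s))))
        (G u - p * F (Suc 0) u - (\<Sum>n<N. p * (1 - p) ^ Suc n * F (Suc (Suc n)) u))"
      by (intro has_bochner_integral_diff has_bochner_integral_sum has_bochner_integral_mult_right F G)
    also have "(\<lambda>s. f s * (p * F 0 (u - s) + (1 - p) * G (u - s)) - p * (f s * F 0 (u - s))
           - (\<Sum>n<N. p * (1 - p) ^ Suc n * (f s * F (Suc n) (u - s))))
         = (\<lambda>s. (1 - p) * (f s * R N (u - s)))"
      by (auto simp: R_def fun_eq_iff algebra_simps sum_distrib_left)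
    also have "G u - p * F (Suc 0) u - (\<Sum>n<N. p * (1 - p) ^ Suc n * F (Suc (Suc n)) u) = R (Suc N) u"
      by (simp add: R_def sum.lessThan_Suc_shift del: sum.lessThan_Suc)
    finally show ?thesis .
  qed
  have Rb: "\<bar>R N u\<bar> \<le> C * (1 - p) ^ N" if "u \<le> t" for N u
    using that
  proof (induction N arbitrary: u)
    case 0
    then show ?case using bound by (simp add: R_def)
  next
    case (Suc N)
    have "\<bar>R (Suc N) u\<bar> = \<bar>\<integral>s. (1 - p) * (f s * R N (u - s)) \<partial>lborel\<bar>"
      by (simp only: has_bochner_integral_integral_eq[OF R])
    also have "\<dots> \<le> (\<integral>s. \<bar>(1 - p) * (f s * R N (u - s))\<bar> \<partial>lborel)"
      by (rule integral_abs_bound)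
    also have "\<dots> \<le> (\<integral>s. C * (1 - p) ^ Suc N * f s \<partial>lborel)"
    proof (rule integral_mono)
      show "integrable lborel (\<lambda>s. \<bar>(1 - p) * (f s * R N (u - s))\<bar>)"
        using R by (intro integrable_abs) (auto simp: has_bochner_integral_iff)
      show "integrable lborel (\<lambda>s. C * (1 - p) ^ Suc N * f s)"
        using f(3) by (intro integrable_mult_right) (auto simp: has_bochner_integral_iff)
      show "\<bar>(1 - p) * (f s * R N (u - s))\<bar> \<le> C * (1 - p) ^ Suc N * f s" for s
      proof (cases "s \<le> 0")
        case False
        then have "(1 - p) * f s * \<bar>R N (u - s)\<bar> \<le> (1 - p) * f s * (C * (1 - p) ^ N)"
          using Suc p f(1) by (intro mult_left_mono Suc.IH) auto
        then show ?thesis using p f(1)[of s] by (simp add: abs_mult mult_ac)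
      qed (simp add: f(2))
    qed
    also have "\<dots> = C * (1 - p) ^ Suc N"
      using f(3) by (simp add: has_bochner_integral_iff)
    finally show ?case .
  qed
  have "(\<lambda>N. C * (1 - p) ^ N) \<longlonglongrightarrow> C * 0"
    using p by (intro tendsto_mult tendsto_const LIMSEQ_power_zero) auto
  then have "(\<lambda>N. R N t) \<longlonglongrightarrow> 0"
    by (intro Lim_null_comparison[of "\<lambda>N. R N t"]) (auto intro!: always_eventually Rb)
  then have "(\<lambda>N. G t - R N t) \<longlonglongrightarrow> G t - 0" by (intro tendsto_intros)
  then show ?thesis by (simp add: sums_def R_def)
qed

lemma frac_series_cmult:
  assumes "0 < a" "0 < b" and d: "\<And>r. \<bar>d r\<bar> \<le> D * B ^ r"
  shows "frac_series a b (\<lambda>r. q * d r) t = q * frac_series a b d t"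
  unfolding frac_series_def mult.assoc
  by (rule suminf_mult[OF summable_rabs_cancel[OF frac_series_summable[OF assms]]])

text \<open>For parameters at least 1 the kernels are nondecreasing, so the absolute series at
  \<open>t\<close> is a uniform bound to the left of \<open>t\<close>.\<close>

lemma frac_series_bounded_above:
  assumes "0 < a" "1 \<le> b" and d: "\<And>r. \<bar>d r\<bar> \<le> D * B ^ r" and "u \<le> t"
  shows "\<bar>frac_series a b d u\<bar> \<le> (\<Sum>r. \<bar>d r * frac_kernel (a * real r + b) t\<bar>)"
proof -
  have s: "summable (\<lambda>r. \<bar>d r * frac_kernel (a * real r + b) u\<bar>)" for u
    using assms by (intro frac_series_summable[where D = D and B = B]) auto
  have "\<bar>frac_series a b d u\<bar> \<le> (\<Sum>r. \<bar>d r * frac_kernel (a * real r + b) u\<bar>)"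
    unfolding frac_series_def by (rule summable_rabs[OF s])
  also have "\<dots> \<le> (\<Sum>r. \<bar>d r * frac_kernel (a * real r + b) t\<bar>)"
  proof (intro suminf_le s)
    fix r :: nat
    have b: "1 \<le> a * real r + b" using assms by (simp add: add_increasing)
    then have "0 \<le> frac_kernel (a * real r + b) u"
      by (intro frac_kernel_nonneg) auto
    moreover have "frac_kernel (a * real r + b) u \<le> frac_kernel (a * real r + b) t"
      using b \<open>u \<le> t\<close> by (auto simp: frac_kernel_def intro!: divide_right_mono powr_mono2 less_imp_le[OF Gamma_real_pos] divide_nonneg_nonneg)
    ultimately show "\<bar>d r * frac_kernel (a * real r + b) u\<bar> \<le> \<bar>d r * frac_kernel (a * real r + b) t\<bar>"
      by (simp add: abs_mult mult_left_mono)
  qed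
  finally show ?thesis .
qed

lemma fpp_density_renewal_equation:
  fixes p L nu :: real
  defines "G \<equiv> frac_series nu (nu + 1) (\<lambda>r. p * L * (- (p * L)) ^ r)"
  assumes "0 < nu" "0 < L" "0 < p" "p \<le> 1"
  shows "has_bochner_integral lborel
    (\<lambda>s. fpp_density nu L s * (p * of_bool (s \<le> u) + (1 - p) * G (u - s))) (G u)"
proof -
  define c where "c = p * L"
  have c: "0 \<le> c" "c \<le> L" using assms by (auto simp: c_def mult_left_le_one_le)
  \<comment> \<open>Coefficients of \<open>p * frac_kernel 1 + (1 - p) * G\<close> as one series of
    parameter 1: those of \<open>G\<close> move up one place because
    \<open>nu * r + (nu + 1) = nu * (r + 1) + 1\<close>.\<close>
  define e where "e r = (case r of 0 \<Rightarrow> p | Suc r \<Rightarrow> (1 - p) * (c * (- c) ^ r))" for r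
  have e: "\<bar>e r\<bar> \<le> 1 * L ^ r" for r
  proof (cases r)
    case (Suc m)
    have "(1 - p) * (c * c ^ m) \<le> 1 * (L * L ^ m)"
      using assms c by (intro mult_mono power_mono) auto
    then show ?thesis using Suc assms c by (simp add: e_def abs_mult power_abs)
  qed (use assms in \<open>simp add: e_def\<close>)
  have e_simps: "e 0 = p" "e (Suc r) = (1 - p) * (c * (- c) ^ r)" for r by (simp_all add: e_def)
  have cb: "\<bar>c * (- c) ^ r\<bar> \<le> c * c ^ r" for r using c by (simp add: abs_mult power_abs)
  have split: "frac_series nu 1 e v = p * frac_kernel 1 v + (1 - p) * G v" for v
  proof -
    have "frac_series nu (nu + 1) (\<lambda>r. (1 - p) * (c * (- c) ^ r)) v = (1 - p) * G v"
      unfolding G_def c_def[symmetric] using assms(2) cb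
      by (intro frac_series_cmult[where D = c and B = c]) auto
    then show ?thesis
      using frac_series_split_head[OF \<open>0 < nu\<close> zero_less_one e, of v] by (simp only: e_simps)
  qed
  \<comment> \<open>In generating functions: \<open>e\<close> has
    \<open>p * (1 + L z) / (1 + c z)\<close>, so multiplying by \<open>L / (1 + L z)\<close> leaves
    \<open>c / (1 + c z)\<close>.\<close>
  have coeff: "(\<Sum>i\<le>m. L * (- L) ^ i * e (m - i)) = c * (- c) ^ m" for m
  proof (induction m)
    case 0
    then show ?case by (simp add: e_def c_def)
  next
    case (Suc m)
    have "(\<Sum>i\<le>Suc m. L * (- L) ^ i * e (Suc m - i)) = L * e (Suc m) + (\<Sum>i\<le>m. (- L) * (L * (- L) ^ i * e (m - i)))"
      by (subst sum.atMost_Suc_shift) (simp add: mult_ac)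
    also have "\<dots> = L * e (Suc m) - L * (c * (- c) ^ m)"
      by (simp only: sum_distrib_left[symmetric] Suc)
    finally show ?case by (simp add: e_def c_def algebra_simps)
  qed
  have "has_bochner_integral lborel (\<lambda>s. frac_series nu nu (\<lambda>r. L * (- L) ^ r) s * frac_series nu 1 e (u - s))
     (frac_series nu (nu + 1) (\<lambda>m. \<Sum>i\<le>m. L * (- L) ^ i * e (m - i)) u)"
    using assms e by (intro frac_series_convolution[where D = L and B = L and C = 1]) (auto simp: abs_mult power_abs)
  then have *: "has_bochner_integral lborel (\<lambda>s. fpp_density nu L s * (p * frac_kernel 1 (u - s) + (1 - p) * G (u - s))) (G u)"
    by (simp add: coeff split G_def c_def fpp_density_eq_frac_series[OF \<open>0 < nu\<close>])
  have [measurable]: "fpp_density nu L \<in> borel_measurable borel" 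
    by (subst fpp_density_eq_frac_series[OF \<open>0 < nu\<close>, abs_def]) measurable
  have [measurable]: "G \<in> borel_measurable borel" unfolding G_def by measurable
  \<comment> \<open>\<open>frac_kernel 1 (u - s)\<close> is the indicator of \<open>s < u\<close>;
    it differs from that of \<open>s <= u\<close> only at one point.\<close>
  have ae: "AE s in lborel. fpp_density nu L s * (p * frac_kernel 1 (u - s) + (1 - p) * G (u - s))
      = fpp_density nu L s * (p * of_bool (s \<le> u) + (1 - p) * G (u - s))"
    using AE_lborel_singleton[of u] by eventually_elim (auto simp: frac_kernel_def)
  show ?thesis
    by (subst has_bochner_integral_cong_AE[OF _ _ ae, symmetric]) (use * in measurable)
qed

subsection \<open>The first mark time\<close>

text \<open>Positive gaps make the arrival times increase, so at most \<open>n\<close> could be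
  counted if arrival \<open>Suc n\<close> came after \<open>s\<close>. Indices start at 0:
  \<open>X n\<close> marks the arrival at the sum over \<open>i < Suc n\<close>.\<close>

lemma renewal_count_ge:
  assumes "\<And>i. 0 < T i \<omega>" "n < renewal_count T s \<omega>"
  shows "(\<Sum>i<Suc n. T i \<omega>) \<le> s"
proof (rule ccontr)
  assume *: "\<not> (\<Sum>i<Suc n. T i \<omega>) \<le> s"
  have "m \<le> n" if "(\<Sum>i<m. T i \<omega>) \<le> s" for m
  proof (rule ccontr)
    assume "\<not> m \<le> n"
    then have "(\<Sum>i<Suc n. T i \<omega>) \<le> (\<Sum>i<m. T i \<omega>)"
      using assms(1) by (intro sum_mono2) (auto intro: less_imp_le)
    with * that show False by simp
  qed
  then have "{m. 1 \<le> m \<and> (\<Sum>i<m. T i \<omega>) \<le> s} \<subseteq> {1..n}" by auto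
  from card_mono[OF _ this] assms(2) show False by (simp add: renewal_count_def)
qed

lemma renewal_count_arrival:
  assumes "\<And>i. 0 < T i \<omega>"
  shows "renewal_count T (\<Sum>i<n. T i \<omega>) \<omega> = n"
proof -
  have mono: "strict_mono (\<lambda>m. \<Sum>i<m. T i \<omega>)"
    using assms by (intro strict_monoI_Suc) simp
  have "{m. 1 \<le> m \<and> (\<Sum>i<m. T i \<omega>) \<le> (\<Sum>i<n. T i \<omega>)} = {1..n}"
    using strict_mono_less_eq[OF mono] by auto
  then show ?thesis by (simp add: renewal_count_def)
qed

text \<open>The count is 1 at the arrival carrying the first mark \<open>j\<close>, and any time
  with count 1 is at or after that arrival. Hence the infimum is attained there.\<close>

lemma first_mark_time_le_iff:
  assumes pos: "\<And>i. 0 < T i \<omega>"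
  shows "first_mark_time T X j \<omega> \<le> ereal t \<longleftrightarrow>
    (\<exists>n. X n \<omega> = j \<and> (\<forall>i<n. X i \<omega> \<noteq> j) \<and> (\<Sum>i<Suc n. T i \<omega>) \<le> t)"
proof
  assume "\<exists>n. X n \<omega> = j \<and> (\<forall>i<n. X i \<omega> \<noteq> j) \<and> (\<Sum>i<Suc n. T i \<omega>) \<le> t"
  then obtain n where n: "X n \<omega> = j" "\<And>i. i < n \<Longrightarrow> X i \<omega> \<noteq> j" and t: "(\<Sum>i<Suc n. T i \<omega>) \<le> t"
    by blast
  have "{i. i < Suc n \<and> X i \<omega> = j} = {n}" using n by (auto simp: less_Suc_eq)
  then have "mark_count T X j (\<Sum>i<Suc n. T i \<omega>) \<omega> = 1"
    unfolding mark_count_def renewal_count_arrival[of T \<omega>, OF pos] by simp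
  moreover have "0 < (\<Sum>i<Suc n. T i \<omega>)" using pos by (intro sum_pos) auto
  ultimately have "first_mark_time T X j \<omega> \<le> ereal (\<Sum>i<Suc n. T i \<omega>)"
    unfolding first_mark_time_def by (intro Inf_lower) blast
  also have "\<dots> \<le> ereal t" using t by simp
  finally show "first_mark_time T X j \<omega> \<le> ereal t" .
next
  assume H: "first_mark_time T X j \<omega> \<le> ereal t"
  \<comment> \<open>If the mark never occurs, the infimum of the empty set is infinite.\<close>
  have "\<exists>i. X i \<omega> = j"
  proof (rule ccontr)
    assume "\<not> ?thesis"
    then have "first_mark_time T X j \<omega> = \<infinity>"
      by (simp add: first_mark_time_def mark_count_def top_ereal_def)
    with H show False by simp
  qed
  define n where "n = (LEAST i. X i \<omega> = j)"
  have n: "X n \<omega> = j" "\<And>i. X i \<omega> = j \<Longrightarrow> n \<le> i"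
    unfolding n_def using \<open>\<exists>i. X i \<omega> = j\<close> by (auto intro: LeastI_ex Least_le)
  have "ereal (\<Sum>i<Suc n. T i \<omega>) \<le> first_mark_time T X j \<omega>"
    unfolding first_mark_time_def
  proof (rule Inf_greatest)
    fix y assume "y \<in> {ereal s | s. 0 < s \<and> mark_count T X j s \<omega> = 1}"
    then obtain s where s: "y = ereal s" "mark_count T X j s \<omega> = 1" by blast
    then obtain i where "i < renewal_count T s \<omega>" "X i \<omega> = j"
      by (auto simp: mark_count_def card_1_singleton_iff)
    with n(2)[of i] have "n < renewal_count T s \<omega>" by simp
    with s show "ereal (\<Sum>i<Suc n. T i \<omega>) \<le> y"
      using renewal_count_ge[of T \<omega>, OF pos] by auto
  qed
  with H have "(\<Sum>i<Suc n. T i \<omega>) \<le> t" by (metis ereal_less_eq(3) order_trans)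
  with n show "\<exists>n. X n \<omega> = j \<and> (\<forall>i<n. X i \<omega> \<noteq> j) \<and> (\<Sum>i<Suc n. T i \<omega>) \<le> t"
    by (metis not_less)
qed

text \<open>No arrival is gained or lost between the latest counted arrival time and
  \<open>s\<close>. The latest one exists: a positive count means a finite nonempty set, as infinite
  sets have \<open>card\<close> 0.\<close>

lemma mark_count_constant_left:
  assumes s: "0 < s" "mark_count T X j s \<omega> = 1"
  obtains n where "(\<Sum>i<n. T i \<omega>) \<le> s"
    and "\<And>u. (\<Sum>i<n. T i \<omega>) \<le> u \<Longrightarrow> u \<le> s \<Longrightarrow> mark_count T X j u \<omega> = 1"
proof -
  define A where "A u = {n. 1 \<le> n \<and> (\<Sum>i<n. T i \<omega>) \<le> u}" for u
  have "0 < renewal_count T s \<omega>"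
    using s by (cases "renewal_count T s \<omega>") (auto simp: mark_count_def)
  then have "finite (A s)" "A s \<noteq> {}"
    unfolding renewal_count_def A_def[symmetric] by (auto simp: card_gt_0_iff)
  then have "Max ((\<lambda>n. \<Sum>i<n. T i \<omega>) ` A s) \<in> (\<lambda>n. \<Sum>i<n. T i \<omega>) ` A s"
    by (intro Max_in) auto
  then obtain n where "n \<in> A s" "Max ((\<lambda>n. \<Sum>i<n. T i \<omega>) ` A s) = (\<Sum>i<n. T i \<omega>)" by blast
  then have n: "n \<in> A s" "\<And>m. m \<in> A s \<Longrightarrow> (\<Sum>i<m. T i \<omega>) \<le> (\<Sum>i<n. T i \<omega>)"
    using Max_ge[of "(\<lambda>n. \<Sum>i<n. T i \<omega>) ` A s"] \<open>finite (A s)\<close> by auto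
  show ?thesis
  proof (rule that)
    show "(\<Sum>i<n. T i \<omega>) \<le> s" using n by (simp add: A_def)
    fix u assume "(\<Sum>i<n. T i \<omega>) \<le> u" "u \<le> s"
    then have "A u = A s" using n(2) by (force simp: A_def)
    then show "mark_count T X j u \<omega> = 1"
      using s(2) by (simp add: mark_count_def renewal_count_def A_def)
  qed
qed

text \<open>Measurability has to hold on the null set of non-increasing arrival times too, since \<open>M\<close> need not
  be complete and \<open>measure\<close> is 0 on non-measurable sets. There the rational candidates cover the
  case that the mark count is already 1 immediately after time 0.\<close>
lemma first_mark_time_eq_countable_INF:
  "first_mark_time T X j \<omega> =
    inf (INF n. if 0 < (\<Sum>i<n. T i \<omega>) \<and> mark_count T X j (\<Sum>i<n. T i \<omega>) \<omega> = 1 then ereal (\<Sum>i<n. T i \<omega>) else \<infinity>)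
        (INF q. if 0 < real_of_rat q \<and> mark_count T X j (real_of_rat q) \<omega> = 1 then ereal (real_of_rat q) else \<infinity>)"
  (is "?H = inf (INF n. ?a n) (INF q. ?b q)")
proof (rule antisym)
  show "?H \<le> inf (INF n. ?a n) (INF q. ?b q)"
    unfolding first_mark_time_def by (intro le_infI INF_greatest) (auto intro!: Inf_lower)
  show "inf (INF n. ?a n) (INF q. ?b q) \<le> ?H"
    unfolding first_mark_time_def
  proof (rule Inf_greatest)
    fix y assume "y \<in> {ereal s | s. 0 < s \<and> mark_count T X j s \<omega> = 1}"
    then obtain s where y: "y = ereal s" and s: "0 < s" "mark_count T X j s \<omega> = 1" by blast
    obtain n where n: "(\<Sum>i<n. T i \<omega>) \<le> s"
      "\<And>u. (\<Sum>i<n. T i \<omega>) \<le> u \<Longrightarrow> u \<le> s \<Longrightarrow> mark_count T X j u \<omega> = 1"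
      using mark_count_constant_left[of s T X j \<omega>, OF s] by blast
    show "inf (INF n. ?a n) (INF q. ?b q) \<le> y"
    proof (cases "0 < (\<Sum>i<n. T i \<omega>)")
      case True
      have "(INF n. ?a n) \<le> ?a n" by (rule INF_lower) simp
      also have "\<dots> \<le> y" using True n y by simp
      finally show ?thesis by (rule le_infI1)
    next
      case False
      \<comment> \<open>The count is 1 on all of \<open>(0, s]\<close> here, so every positive
        rational below \<open>s\<close> is a candidate.\<close>
      obtain q where q: "0 < real_of_rat q" "real_of_rat q < s" using of_rat_dense[OF s(1)] by blast
      have "(INF q. ?b q) \<le> ?b q" by (rule INF_lower) simp
      also have "\<dots> \<le> y" using False n(2)[of "real_of_rat q"] q y by simp
      finally show ?thesis by (rule le_infI2)
    qed
  qed
qed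

lemma first_mark_time_measurable:
  assumes [measurable]: "\<And>n. T n \<in> borel_measurable M"
    and [measurable]: "\<And>n. X n \<in> measurable M (count_space UNIV)"
  shows "first_mark_time T X j \<in> borel_measurable M"
proof -
  \<comment> \<open>The candidate times include random arrival times, so the counts are needed at a
    measurable random time \<open>g\<close>.\<close>
  have N [measurable]: "(\<lambda>\<omega>. renewal_count T (g \<omega>) \<omega>) \<in> measurable M (count_space UNIV)"
    if [measurable]: "g \<in> borel_measurable M" for g
    unfolding renewal_count_def by measurable
  have [measurable]: "(\<lambda>\<omega>. mark_count T X j (g \<omega>) \<omega>) \<in> measurable M (count_space UNIV)"
    if [measurable]: "g \<in> borel_measurable M" for g
    unfolding mark_count_def by measurable
  show ?thesis
    unfolding first_mark_time_eq_countable_INF[abs_def] by measurable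
qed

subsection \<open>Distribution of the first mark time\<close>

text \<open>By independence the law of the next arrival time is a convolution; integrating out
  \<open>T n\<close> against its density gives the recursion.\<close>

lemma (in prob_space) renewal_cdf_recursion:
  fixes T :: "nat \<Rightarrow> 'a \<Rightarrow> real" and f :: "real \<Rightarrow> real"
  assumes indep: "indep_var borel (T n) borel (\<lambda>\<omega>. \<Sum>i<n. T i \<omega>)"
    and T: "distributed M lborel (T n) (\<lambda>x. ennreal (f x))"
    and f: "\<And>x. 0 \<le> f x" "f \<in> borel_measurable borel"
  shows "has_bochner_integral lborel (\<lambda>s. f s * prob {\<omega> \<in> space M. (\<Sum>i<n. T i \<omega>) \<le> u - s})
    (prob {\<omega> \<in> space M. (\<Sum>i<Suc n. T i \<omega>) \<le> u})"
proof -
  define S where "S \<omega> = (\<Sum>i<n. T i \<omega>)" for \<omega>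
  define F where "F v = prob {\<omega> \<in> space M. S \<omega> \<le> v}" for v
  have [measurable]: "random_variable borel (T n)" "random_variable borel S"
    using indep_var_rv1[OF indep] indep_var_rv2[OF indep] by (auto simp: S_def[abs_def])
  have indep': "indep_var borel (T n) borel S" using indep by (simp add: S_def[abs_def])
  note [measurable] = f(2)
  have "mono F"
    unfolding F_def by (intro monoI finite_measure_mono) auto
  then have [measurable]: "F \<in> borel_measurable borel" by (rule borel_measurable_mono)
  interpret TD: prob_space "distr M borel (T n)" by (rule prob_space_distr) simp
  interpret SD: prob_space "distr M borel S" by (rule prob_space_distr) simp
  have "distr M borel (T n) = distr M lborel (T n)" by (rule distr_cong) auto
  then have D: "distr M borel (T n) = density lborel (\<lambda>x. ennreal (f x))"
    using T by (simp add: distributed_def)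
  have "{\<omega> \<in> space M. (\<Sum>i<Suc n. T i \<omega>) \<le> u} = (\<lambda>\<omega>. T n \<omega> + S \<omega>) -` {..u} \<inter> space M"
    by (auto simp: S_def add.commute)
  then have "ennreal (prob {\<omega> \<in> space M. (\<Sum>i<Suc n. T i \<omega>) \<le> u})
      = emeasure (distr M borel (\<lambda>\<omega>. T n \<omega> + S \<omega>)) {..u}"
    by (simp add: emeasure_distr emeasure_eq_measure)
  also have "\<dots> = emeasure (convolution (distr M borel (T n)) (distr M borel S)) {..u}"
    by (subst sum_indep_random_variable[OF indep']) auto
  also have "\<dots> = (\<integral>\<^sup>+x. emeasure (distr M borel S) {a. a + x \<in> {..u}} \<partial>distr M borel (T n))"
    by (subst convolution_emeasure) (auto simp: TD.finite_measure_axioms SD.finite_measure_axioms add.commute)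
  also have "\<dots> = (\<integral>\<^sup>+x. ennreal (F (u - x)) \<partial>distr M borel (T n))"
  proof (rule nn_integral_cong)
    fix x :: real
    have "S -` {a. a + x \<in> {..u}} \<inter> space M = {\<omega> \<in> space M. S \<omega> \<le> u - x}" by auto
    then show "emeasure (distr M borel S) {a. a + x \<in> {..u}} = ennreal (F (u - x))"
      by (subst emeasure_distr) (auto simp: F_def emeasure_eq_measure)
  qed
  also have "\<dots> = (\<integral>\<^sup>+x. ennreal (f x * F (u - x)) \<partial>lborel)"
    unfolding D by (subst nn_integral_density) (auto simp: ennreal_mult' f(1))
  finally have "(\<integral>\<^sup>+x. ennreal (f x * F (u - x)) \<partial>lborel)
      = ennreal (prob {\<omega> \<in> space M. (\<Sum>i<Suc n. T i \<omega>) \<le> u})" by simp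
  then have "has_bochner_integral lborel (\<lambda>x. f x * F (u - x)) (prob {\<omega> \<in> space M. (\<Sum>i<Suc n. T i \<omega>) \<le> u})"
    by (intro has_bochner_integral_nn_integral) (auto simp: f(1) F_def)
  then show ?thesis by (simp add: F_def S_def)
qed

lemma (in prob_space) indep_var_waiting_time_arrival:
  fixes T :: "nat \<Rightarrow> 'a \<Rightarrow> real" and Y :: "'i \<Rightarrow> 'a \<Rightarrow> real"
  assumes "indep_vars (\<lambda>_. borel) (case_sum T Y) UNIV"
  shows "indep_var borel (T n) borel (\<lambda>\<omega>. \<Sum>i<n. T i \<omega>)"
proof -
  have "indep_var borel (case_sum T Y (Inl n)) borel (\<lambda>\<omega>. \<Sum>i\<in>Inl ` {..<n}. case_sum T Y i \<omega>)"
    by (intro indep_vars_sum indep_vars_subset[OF assms]) auto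
  then show ?thesis by (simp add: sum.reindex)
qed

text \<open>The arrival time and the marks up to \<open>n\<close> depend on disjoint blocks of the
  independent family. The product rule gives \<open>p\<close> for mark \<open>n\<close> and
  \<open>1 - p\<close> for each earlier one.\<close>

lemma (in prob_space) prob_first_mark_arrival:
  fixes T :: "nat \<Rightarrow> 'a \<Rightarrow> real" and X :: "nat \<Rightarrow> 'a \<Rightarrow> nat"
  assumes indep: "indep_vars (\<lambda>_. borel) (case_sum T (\<lambda>i \<omega>. real (X i \<omega>))) UNIV"
    and X: "\<And>n. prob {\<omega> \<in> space M. X n \<omega> = j} = p"
  shows "prob {\<omega> \<in> space M. X n \<omega> = j \<and> (\<forall>i<n. X i \<omega> \<noteq> j) \<and> (\<Sum>i<Suc n. T i \<omega>) \<le> t}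
    = p * (1 - p) ^ n * prob {\<omega> \<in> space M. (\<Sum>i<Suc n. T i \<omega>) \<le> t}"
proof -
  let ?V = "case_sum T (\<lambda>i \<omega>. real (X i \<omega>))"
  \<comment> \<open>\<open>None\<close> indexes the block of waiting times and \<open>Some i\<close>
    the single mark \<open>i\<close>; \<open>Y\<close> computes the variable \<open>Z\<close> from
    its block, and \<open>A\<close> holds the prescribed values.\<close>
  define K :: "nat option \<Rightarrow> (nat + nat) set"
    where "K l = (case l of None \<Rightarrow> Inl ` {..<Suc n} | Some i \<Rightarrow> {Inr i})" for l
  define Y :: "nat option \<Rightarrow> (nat + nat \<Rightarrow> real) \<Rightarrow> real"
    where "Y l g = (case l of None \<Rightarrow> \<Sum>i<Suc n. g (Inl i) | Some i \<Rightarrow> g (Inr i))" for l g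
  define Z where "Z l \<omega> = (case l of None \<Rightarrow> \<Sum>i<Suc n. T i \<omega> | Some i \<Rightarrow> real (X i \<omega>))" for l \<omega>
  define A where "A l = (case l of None \<Rightarrow> {..t} | Some i \<Rightarrow> if i = n then {real j} else - {real j})" for l
  define J where "J = insert None (Some ` {..n})"
  have "indep_vars (\<lambda>l. PiM (K l) (\<lambda>_. borel)) (\<lambda>l \<omega>. restrict (\<lambda>i. ?V i \<omega>) (K l)) UNIV"
    by (intro indep_vars_restrict[OF indep]) (auto simp: disjoint_family_on_def K_def split: option.splits)
  then have "indep_vars (\<lambda>_. borel) (\<lambda>l \<omega>. Y l (restrict (\<lambda>i. ?V i \<omega>) (K l))) UNIV"
  proof (rule indep_vars_compose2)
    fix l
    show "Y l \<in> PiM (K l) (\<lambda>_. borel) \<rightarrow>\<^sub>M borel"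
      unfolding Y_def[abs_def] K_def by (cases l) (auto intro!: borel_measurable_sum measurable_component_singleton)
  qed
  also have "(\<lambda>l \<omega>. Y l (restrict (\<lambda>i. ?V i \<omega>) (K l))) = Z"
    by (intro ext) (auto simp: Y_def K_def Z_def split: option.splits)
  finally have Z: "indep_vars (\<lambda>_. borel) Z UNIV" .
  have rv: "random_variable borel (Z l)" for l using Z by (auto simp: indep_vars_def)
  have XZ: "Z (Some i) -` {real j} \<inter> space M = {\<omega> \<in> space M. X i \<omega> = j}" for i
    by (auto simp: Z_def)
  have "prob (\<Inter>l\<in>J. Z l -` A l \<inter> space M) = (\<Prod>l\<in>J. prob (Z l -` A l \<inter> space M))"
    by (rule indep_varsD[OF Z]) (auto simp: J_def A_def split: option.splits)
  also have "\<dots> = prob (Z None -` A None \<inter> space M) * (\<Prod>i\<le>n. prob (Z (Some i) -` A (Some i) \<inter> space M))"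
    unfolding J_def by (subst prod.insert) (auto simp: prod.reindex)
  also have "(\<Prod>i\<le>n. prob (Z (Some i) -` A (Some i) \<inter> space M)) = (\<Prod>i\<le>n. if i = n then p else 1 - p)"
  proof (rule prod.cong)
    fix i
    have "Z (Some i) -` (- {real j}) \<inter> space M = space M - (Z (Some i) -` {real j} \<inter> space M)" by auto
    moreover have "prob (space M - (Z (Some i) -` {real j} \<inter> space M)) = 1 - p"
      using rv by (subst prob_compl) (auto simp: XZ[symmetric] X[unfolded XZ[symmetric]])
    ultimately show "prob (Z (Some i) -` A (Some i) \<inter> space M) = (if i = n then p else 1 - p)"
      using X XZ by (simp add: A_def)
  qed simp
  also have "(\<Prod>i\<le>n. if i = n then p else 1 - p) = p * (1 - p) ^ n"
    by (simp add: lessThan_Suc_atMost[symmetric])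
  also have "Z None -` A None \<inter> space M = {\<omega> \<in> space M. (\<Sum>i<Suc n. T i \<omega>) \<le> t}"
    by (auto simp: Z_def A_def)
  also have "(\<Inter>l\<in>J. Z l -` A l \<inter> space M)
      = {\<omega> \<in> space M. X n \<omega> = j \<and> (\<forall>i<n. X i \<omega> \<noteq> j) \<and> (\<Sum>i<Suc n. T i \<omega>) \<le> t}"
  proof -
    have "(\<forall>l\<in>J. Z l \<omega> \<in> A l) \<longleftrightarrow> (\<Sum>i<Suc n. T i \<omega>) \<le> t \<and> (\<forall>i\<le>n. (i = n) = (X i \<omega> = j))" for \<omega>
      unfolding J_def Z_def A_def by (simp del: sum.lessThan_Suc) blast
    moreover have "(\<forall>i\<le>n. (i = n) = (X i \<omega> = j)) \<longleftrightarrow> X n \<omega> = j \<and> (\<forall>i<n. X i \<omega> \<noteq> j)" for \<omega>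
      by (auto simp: le_less)
    moreover have "J \<noteq> {}" by (simp add: J_def)
    ultimately show ?thesis by blast
  qed
  finally show ?thesis by (simp add: mult_ac)
qed

section \<open>The law of the first mark time\<close>

theorem theorem3p1:
  fixes M :: "'a measure"
    and T :: "nat \<Rightarrow> 'a \<Rightarrow> real"
    and X :: "nat \<Rightarrow> 'a \<Rightarrow> nat"
    and lam :: "nat \<Rightarrow> real"
    and nu t :: real
    and k j :: nat
  assumes "prob_space M"
    and "0 < nu" and "nu \<le> 1"
    and "\<And>i. i \<in> {1..k} \<Longrightarrow> 0 < lam i"
    and "prob_space.indep_vars M (\<lambda>_. borel) (case_sum T (\<lambda>i \<omega>. real (X i \<omega>))) UNIV"
    and "\<And>n. distributed M lborel (T n)
               (\<lambda>x. ennreal (fpp_density nu (\<Sum>i=1..k. lam i) x))"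
    and "\<And>n i. i \<in> {1..k} \<Longrightarrow>
               measure M {\<omega> \<in> space M. X n \<omega> = i} = lam i / (\<Sum>i=1..k. lam i)"
    and "j \<in> {1..k}"
    and "0 < t"
  shows "measure M {\<omega> \<in> space M. first_mark_time T X j \<omega> \<le> ereal t}
           = lam j * t powr nu * mittag_leffler nu (nu + 1) (- lam j * t powr nu)"
proof -
  interpret prob_space M by fact
  define L where "L = (\<Sum>i=1..k. lam i)"
  define p where "p = lam j / L"
  define f where "f = fpp_density nu L"
  define G where "G = frac_series nu (nu + 1) (\<lambda>r. p * L * (- (p * L)) ^ r)"
  define F where "F n u = prob {\<omega> \<in> space M. (\<Sum>i<n. T i \<omega>) \<le> u}" for n u
  define E where "E n = {\<omega> \<in> space M. X n \<omega> = j \<and> (\<forall>i<n. X i \<omega> \<noteq> j) \<and> (\<Sum>i<Suc n. T i \<omega>) \<le> t}" for n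
  have lamj: "0 < lam j" "lam j \<le> L"
    using assms(4,8) member_le_sum[of j "{1..k}" lam] by (auto simp: L_def less_imp_le)
  then have L: "0 < L" and p: "0 < p" "p \<le> 1" and pL: "p * L = lam j" by (auto simp: p_def)
  have indep: "indep_vars (\<lambda>_. borel) (case_sum T (\<lambda>i \<omega>. real (X i \<omega>))) UNIV"
    using assms(5) .
  have rv: "random_variable borel (case_sum T (\<lambda>i \<omega>. real (X i \<omega>)) l)" for l
    using indep by (auto simp: indep_vars_def)
  have T [measurable]: "random_variable borel (T n)" for n using rv[of "Inl n"] by simp
  have X [measurable]: "random_variable (count_space UNIV) (X n)" for n
  proof -
    have "random_variable borel (\<lambda>\<omega>. real (X n \<omega>))" using rv[of "Inr n"] by simp
    \<comment> \<open>Independence provides measurability of \<open>real (X n)\<close> only; the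
      floor recovers \<open>X n\<close>.\<close>
    then have "(\<lambda>\<omega>. nat \<lfloor>real (X n \<omega>)\<rfloor>) \<in> measurable M (count_space UNIV)"
      by (rule measurable_compose) measurable
    then show ?thesis by simp
  qed
  have D: "distributed M lborel (T n) (\<lambda>x. ennreal (f x))" for n
    using assms(6) by (simp add: f_def L_def)
  have f: "0 \<le> f s" "s \<le> 0 \<Longrightarrow> f s = 0" for s
    using fpp_density_nonneg[OF assms(2,3) L] by (simp_all add: f_def fpp_density_def)
  have f_meas [measurable]: "f \<in> borel_measurable borel"
    unfolding f_def by (subst fpp_density_eq_frac_series[OF assms(2), abs_def]) measurable
  \<comment> \<open>Total mass 1 follows from \<open>f\<close> being the density of the law of
    \<open>T 0\<close>.\<close>
  have "(\<integral>\<^sup>+x. ennreal (f x) \<partial>lborel) = 1"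
  proof -
    interpret TD: prob_space "density lborel (\<lambda>x. ennreal (f x))"
      using prob_space_distr[of "T 0" lborel] D[of 0] by (simp add: distributed_def)
    show ?thesis using TD.emeasure_space_1 by (simp add: emeasure_density)
  qed
  then have f1: "has_bochner_integral lborel f 1"
    by (intro has_bochner_integral_nn_integral) (auto simp: f)
  have pos: "AE \<omega> in M. 0 < T n \<omega>" for n
  proof -
    have "AE x in density lborel (\<lambda>x. ennreal (f x)). 0 < x"
      using f(2) by (subst AE_density) (auto simp: not_less intro!: AE_I2 intro: ccontr)
    then have "AE x in distr M lborel (T n). 0 < x"
      by (simp only: distributed_distr_eq_density[OF D])
    then show ?thesis by (rule AE_distrD[rotated]) simp
  qed
  \<comment> \<open>The empty sum gives a unit step at 0, matching the indicator in the renewal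
    equation.\<close>
  have F0: "F 0 u = of_bool (0 \<le> u)" for u
    using prob_space by (simp add: F_def)
  have E_meas [measurable]: "E n \<in> events" for n unfolding E_def by measurable
  have "disjoint_family E"
    unfolding disjoint_family_on_def E_def by (auto, metis linorder_neqE_nat)
  have "prob {\<omega> \<in> space M. first_mark_time T X j \<omega> \<le> ereal t} = prob (\<Union>n. E n)"
  proof (rule finite_measure_eq_AE)
    have "AE \<omega> in M. \<forall>n. 0 < T n \<omega>" using pos by (simp add: AE_all_countable)
    then show "AE \<omega> in M. \<omega> \<in> {\<omega> \<in> space M. first_mark_time T X j \<omega> \<le> ereal t} \<longleftrightarrow> \<omega> \<in> (\<Union>n. E n)"
    proof eventually_elim
      case (elim \<omega>)
      then show ?case using first_mark_time_le_iff[of T \<omega> X j t] by (auto simp: E_def)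
    qed
    have [measurable]: "first_mark_time T X j \<in> borel_measurable M"
      by (intro first_mark_time_measurable T X)
    show "{\<omega> \<in> space M. first_mark_time T X j \<omega> \<le> ereal t} \<in> events" by measurable
  qed auto
  also have "\<dots> = G t"
  \<comment> \<open>One geometric mixture of arrival time distributions sums both to the probability
    of the union and to \<open>G t\<close>.\<close>
  proof (rule sums_unique2)
    have "(\<lambda>n. prob (E n)) sums prob (\<Union>n. E n)"
      using \<open>disjoint_family E\<close> by (intro finite_measure_UNION) auto
    moreover have "prob (E n) = p * (1 - p) ^ n * F (Suc n) t" for n
      unfolding E_def F_def using assms(7,8)
      by (intro prob_first_mark_arrival indep) (auto simp: p_def L_def)
    ultimately show "(\<lambda>n. p * (1 - p) ^ n * F (Suc n) t) sums prob (\<Union>n. E n)" by simp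
    have "has_bochner_integral lborel (\<lambda>s. f s * (p * F 0 (u - s) + (1 - p) * G (u - s))) (G u)" for u
      using fpp_density_renewal_equation[of nu L p u] assms L p by (simp add: f_def G_def F0)
    moreover have "has_bochner_integral lborel (\<lambda>s. f s * F n (u - s)) (F (Suc n) u)" for n u
      unfolding F_def by (intro renewal_cdf_recursion indep_var_waiting_time_arrival[OF indep] D f f_meas)
    moreover have "\<bar>G u\<bar> \<le> (\<Sum>r. \<bar>p * L * (- (p * L)) ^ r * frac_kernel (nu * real r + (nu + 1)) t\<bar>)"
      if "u \<le> t" for u
      unfolding G_def
      using that assms(2) L p by (intro frac_series_bounded_above[where D = "p * L" and B = "p * L"]) (auto simp: abs_mult power_abs)
    ultimately show "(\<lambda>n. p * (1 - p) ^ n * F (Suc n) t) sums G t"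
      by (intro geometric_renewal_sums[OF p f f1])
  qed
  also have "\<dots> = lam j * t powr nu * mittag_leffler nu (nu + 1) (- lam j * t powr nu)"
    unfolding G_def pL using frac_series_geometric[of nu "nu + 1" t "lam j" "- lam j"] assms by simp
  finally show ?thesis .
qed

end
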